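(* Let $F$ be a number field of degree $n$, and let $p \ge 5$ be a prime. Suppose that (i) $\gcd(n,(p-1)/2)=1$; (ii) $p$ is totally ramified in $F$. Then there are no $\lambda, \mu \in \mathcal{O}_F^\times$ with $\lambda + \mu = 1$.
   Context: $\mathcal{O}_F$ denotes the ring of integers of $F$ and $\mathcal{O}_F^\times$ its unit group. *)

theory Defs
  imports "HOL-Algebra.Algebraic_Closure_Type" "HOL-Algebra.Ideal_Product"
begin

text \<open>
  A number field is given as a subfield \<open>F\<close> of an arbitrary field of characteristic 0 (the
  ambient type); \<open>ring.dimension\<close> is a predicate that includes finite dimensionality.
\<close>

definition number_field_of_degree :: "nat \<Rightarrow> 'a::field_char_0 set \<Rightarrow> bool" where
  "number_field_of_degree n F \<longleftrightarrow>
     subfield F ring_of_type_algebra \<and> ring.dimension ring_of_type_algebra n \<rat> F"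

definition ring_of_integers :: "'a::field_char_0 set \<Rightarrow> 'a ring" where
  "ring_of_integers F = ring_of_type_algebra \<lparr> carrier := {x \<in> F. algebraic_int x} \<rparr>"

text \<open>
  \<open>p\<close> is totally ramified in \<open>F\<close> if \<open>p \<O>\<^sub>F = P\<^sup>n\<close> for a prime ideal \<open>P\<close>, where \<open>n = [F : \<rat>]\<close>.
  The power is taken in the multiplicative monoid of ideals.
\<close>

definition totally_ramified :: "nat \<Rightarrow> 'a::field_char_0 set \<Rightarrow> bool" where
  "totally_ramified p F \<longleftrightarrow>
     (\<exists>n P. number_field_of_degree n F \<and> primeideal P (ring_of_integers F) \<and>
        PIdl\<^bsub>ring_of_integers F\<^esub> (of_nat p) = P [^]\<^bsub>ideals_set (ring_of_integers F)\<^esub> n)"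

end

theory Submission
  imports Defs "HOL-Number_Theory.Residues"
begin

text \<open>
  Let \<open>P\<^sup>n = p \<O>\<^sub>F\<close>. The quotient of \<open>\<O>\<^sub>F\<close> by \<open>p\<close> has dimension at most \<open>n\<close> over \<open>\<int>/p\<close>, while the
  chain of powers of \<open>P\<close> drops strictly \<open>n\<close> times, so every integer \<open>x\<close> of \<open>F\<close> is congruent modulo
  \<open>P\<close> to a rational integer \<open>a\<close>. For \<open>w = x - a\<close> the element \<open>w\<^sup>n\<close> is divisible by \<open>p\<close>, which forces
  the minimal polynomial \<open>g\<close> of \<open>w\<close> to be congruent to \<open>X\<^sup>d\<close> modulo \<open>p\<close>, where \<open>d\<close> divides \<open>n\<close>. If \<open>x\<close>
  is a unit, then \<open>g(-a)\<close> is \<open>1\<close> or \<open>-1\<close> (up to sign it is the norm of \<open>x\<close>), hence \<open>a\<^sup>2\<^sup>d\<close> is \<open>1\<close> modulo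
  \<open>p\<close>. As \<open>gcd (2 d) (p - 1) = 2\<close>, already \<open>a\<^sup>2\<close> is \<open>1\<close> modulo \<open>p\<close>. For two units with sum \<open>1\<close> this
  gives \<open>a\<^sup>2\<close>, \<open>(1 - a)\<^sup>2\<close> both congruent to \<open>1\<close>, so \<open>p\<close> divides \<open>3\<close>.
\<close>

section \<open>Minimal polynomials of algebraic integers\<close>

abbreviation ipoly :: "int poly \<Rightarrow> 'a::field_char_0 \<Rightarrow> 'a" where
  "ipoly f x \<equiv> poly (map_poly of_int f) x"

lemma ipoly_add: "ipoly (f + g) x = ipoly f x + ipoly g x"
proof -
  have "map_poly of_int (f + g) = (map_poly of_int f + map_poly of_int g :: 'a poly)"
    by (rule poly_eqI) (simp add: coeff_map_poly)
  then show ?thesis by simp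
qed

lemma ipoly_mult: "ipoly (f * g) x = ipoly f x * ipoly g x"
proof -
  have "map_poly of_int (f * g) = (map_poly of_int f * map_poly of_int g :: 'a poly)"
    by (rule poly_eqI) (simp add: coeff_map_poly coeff_mult)
  then show ?thesis by simp
qed

lemma ipoly_const [simp]: "ipoly [:c:] x = of_int c"
  by (simp add: map_poly_pCons)

lemma ipoly_smult: "ipoly (Polynomial.smult c f) x = of_int c * ipoly f x"
  using ipoly_mult[of "[:c:]" f x] by simp

lemma ipoly_power: "ipoly (f ^ k) x = ipoly f x ^ k"
  by (induction k) (simp_all add: ipoly_mult)

lemma ipoly_sum: "ipoly (\<Sum>i\<in>I. f i) x = (\<Sum>i\<in>I. ipoly (f i) x)"
  by (induction I rule: infinite_finite_induct) (simp_all add: ipoly_add)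

lemma ipoly_altdef: "ipoly f x = (\<Sum>i\<le>Polynomial.degree f. of_int (poly.coeff f i) * x ^ i)"
  by (simp add: poly_altdef coeff_map_poly degree_map_poly)

text \<open>Gauss's lemma: contents multiply, so \<open>c\<close> divides the content of the
  cofactor and can be cancelled. This removes the constant that pseudo-division introduces.\<close>

lemma primitive_dvd_smultD:
  fixes f k :: "int poly"
  assumes "content f = 1" "f dvd Polynomial.smult c k" "c \<noteq> 0"
  shows "f dvd k"
proof -
  obtain q where q: "Polynomial.smult c k = f * q"
    using assms(2) by (elim dvdE)
  have "content (Polynomial.smult c k) = content q"
    using assms(1) by (simp add: q content_mult)
  then have "c dvd content q"
    by (metis content_smult dvd_triv_left normalize_dvd_iff dvd_mult2)
  then obtain q' where "q = [:c:] * q'"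
    by (metis const_poly_dvd_iff_dvd_content dvdE)
  then have "Polynomial.smult c k = Polynomial.smult c (f * q')"
    using q by simp
  then have "k = f * q'"
    using assms(3) by (metis smult_cancel)
  then show ?thesis by simp
qed

text \<open>A primitive annihilating polynomial of least degree divides every other one, by
  pseudo-division. Since it divides a monic one, its leading coefficient is 1 or -1. Staying over
  the integers keeps reduction modulo \<open>p\<close> available.\<close>

lemma algebraic_int_minimal_ipoly:
  fixes x :: "'a::field_char_0"
  assumes "algebraic_int x"
  obtains f where "Polynomial.lead_coeff f = 1" "ipoly f x = 0" "\<And>k. ipoly k x = 0 \<Longrightarrow> f dvd k"
proof -
  obtain h where h: "ipoly h x = 0" "Polynomial.lead_coeff h = 1"
    using assms by (auto simp: algebraic_int_altdef_ipoly)
  have "h \<noteq> 0" using h by auto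
  define P where "P = (\<lambda>f. f \<noteq> 0 \<and> ipoly f x = 0)"
  have "P h" using h \<open>h \<noteq> 0\<close> by (simp add: P_def)
  then obtain g where g: "P g" and min: "\<And>k. P k \<Longrightarrow> Polynomial.degree g \<le> Polynomial.degree k"
    using ex_has_least_nat[of P h Polynomial.degree] by auto
  define f where "f = primitive_part g"
  have f0: "f \<noteq> 0" and cont: "content f = 1" and deg: "Polynomial.degree f = Polynomial.degree g"
    using g by (auto simp: f_def P_def)
  have "of_int (content g) * ipoly f x = 0"
    using g unfolding f_def P_def
    by (metis content_times_primitive_part ipoly_smult)
  then have fx: "ipoly f x = 0" using g by (auto simp: P_def)
  have dvd: "f dvd k" if "ipoly k x = 0" for k
  proof -
    obtain q r where qr: "pseudo_divmod k f = (q, r)" by fastforce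
    define c where "c = Polynomial.lead_coeff f ^ (Suc (Polynomial.degree k) - Polynomial.degree f)"
    have eq: "Polynomial.smult c k = f * q + r"
      and r: "r = 0 \<or> Polynomial.degree r < Polynomial.degree f"
      using pseudo_divmod[OF f0 qr] by (auto simp: c_def)
    have "ipoly r x = 0"
      using arg_cong[OF eq, of "\<lambda>f. ipoly f x"] that fx
      by (simp add: ipoly_add ipoly_mult ipoly_smult)
    then have "r = 0"
      using r min[of r] deg unfolding P_def by linarith
    moreover have "c \<noteq> 0" using f0 by (simp add: c_def)
    ultimately show ?thesis
      using primitive_dvd_smultD[OF cont, of c k] eq by simp
  qed
  obtain q where "h = f * q" using dvd[OF h(1)] by (elim dvdE)
  then have "Polynomial.lead_coeff f * Polynomial.lead_coeff q = 1"
    using h(2) by (simp add: lead_coeff_mult)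
  then have "Polynomial.lead_coeff f = 1 \<or> Polynomial.lead_coeff f = -1"
    by (auto simp: zmult_eq_1_iff)
  then show thesis
  proof
    assume "Polynomial.lead_coeff f = 1"
    then show thesis using that[of f] fx dvd by blast
  next
    assume "Polynomial.lead_coeff f = -1"
    moreover have "ipoly (- f) x = 0"
      using fx ipoly_smult[of "-1" f x] by simp
    ultimately show thesis using that[of "- f"] dvd by simp
  qed
qed

text \<open>Clearing denominators in a monic equation for \<open>y = A(x) / B(x)\<close>.\<close>

lemma algebraic_int_quotient_relation:
  fixes x y :: "'a::field_char_0"
  assumes "algebraic_int y" "ipoly A x = y * ipoly B x"
  obtains m k where "ipoly (A ^ m + B * k) x = 0"
proof -
  obtain h where h: "ipoly h y = 0" "Polynomial.lead_coeff h = 1"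
    using assms(1) by (auto simp: algebraic_int_altdef_ipoly)
  define m where "m = Polynomial.degree h"
  \<comment> \<open>Because \<open>A(x) = y B(x)\<close>, multiplying \<open>h(y)\<close> by
    \<open>B(x)^m\<close> turns its top term into \<open>A(x)^m\<close> and the power
    \<open>y^i\<close> into \<open>A(x)^i B(x)^(m-i)\<close>. The lower terms, with one factor
    \<open>B(x)\<close> taken out, make up \<open>k\<close>.\<close>
  define k where "k = (\<Sum>i<m. Polynomial.smult (poly.coeff h i) (A ^ i * B ^ (m - Suc i)))"
  have "ipoly (A ^ m + B * k) x
      = ipoly A x ^ m + ipoly B x * (\<Sum>i<m. of_int (poly.coeff h i) * (ipoly A x ^ i * ipoly B x ^ (m - Suc i)))"
    by (simp add: k_def ipoly_add ipoly_mult ipoly_sum ipoly_smult ipoly_power)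
  also have "\<dots> = ipoly B x ^ m * y ^ m + (\<Sum>i<m. ipoly B x ^ m * (of_int (poly.coeff h i) * y ^ i))"
  proof -
    have "ipoly B x * (of_int (poly.coeff h i) * (ipoly A x ^ i * ipoly B x ^ (m - Suc i)))
        = ipoly B x ^ m * (of_int (poly.coeff h i) * y ^ i)" if "i < m" for i
    proof -
      have "ipoly B x ^ m = ipoly B x * ipoly B x ^ i * ipoly B x ^ (m - Suc i)"
        using that by (simp flip: power_Suc power_add)
      then show ?thesis
        by (simp add: assms(2) power_mult_distrib mult_ac)
    qed
    then have "ipoly B x * (\<Sum>i<m. of_int (poly.coeff h i) * (ipoly A x ^ i * ipoly B x ^ (m - Suc i)))
        = (\<Sum>i<m. ipoly B x ^ m * (of_int (poly.coeff h i) * y ^ i))"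
      unfolding sum_distrib_left by (intro sum.cong) auto
    then show ?thesis
      by (simp add: assms(2) power_mult_distrib)
  qed
  also have "\<dots> = ipoly B x ^ m * ipoly h y"
    using h(2)
    by (simp add: ipoly_altdef m_def lessThan_Suc_atMost[symmetric] sum_distrib_left distrib_left
        add.commute del: lessThan_Suc_atMost)
  finally show thesis using h that by simp
qed

text \<open>In the convolution at index \<open>i + j\<close>, only the term at \<open>l = i\<close>
  escapes divisibility by \<open>p\<close>.\<close>

lemma coeff_mult_not_dvd:
  fixes f g :: "int poly" and p :: int
  assumes "Factorial_Ring.prime p"
    and "\<not> p dvd poly.coeff f i" "\<not> p dvd poly.coeff g j"
    and "\<And>l. l \<le> i + j \<Longrightarrow> l \<noteq> i \<Longrightarrow> p dvd poly.coeff f l \<or> p dvd poly.coeff g (i + j - l)"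
  shows "\<not> p dvd poly.coeff (f * g) (i + j)"
proof -
  have "poly.coeff (f * g) (i + j)
      = poly.coeff f i * poly.coeff g j + (\<Sum>l\<in>{..i + j} - {i}. poly.coeff f l * poly.coeff g (i + j - l))"
    by (simp add: coeff_mult sum.remove[of _ i])
  moreover have "p dvd (\<Sum>l\<in>{..i + j} - {i}. poly.coeff f l * poly.coeff g (i + j - l))"
  proof (rule dvd_sum)
    fix l assume "l \<in> {..i + j} - {i}"
    then have "p dvd poly.coeff f l \<or> p dvd poly.coeff g (i + j - l)"
      using assms(4)[of l] by blast
    then show "p dvd poly.coeff f l * poly.coeff g (i + j - l)"
      by (elim disjE) (simp_all only: dvd_mult dvd_mult2)
  qed
  moreover have "\<not> p dvd poly.coeff f i * poly.coeff g j"
    using assms(1-3) by (simp add: prime_dvd_mult_iff)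
  ultimately show ?thesis
    by (simp add: dvd_add_left_iff)
qed

text \<open>
  Modulo \<open>p\<close>, the product of the lowest terms of \<open>g\<close> and its cofactor and the product of their highest
  terms both survive, so both are the term \<open>X\<^sup>N\<close>.
\<close>

lemma monic_dvd_monom_mod_prime:
  fixes g :: "int poly" and p :: int
  assumes p: "Factorial_Ring.prime p"
    and monic: "Polynomial.lead_coeff g = 1"
    and dvd: "g dvd Polynomial.monom 1 N + Polynomial.smult p k"
    and i: "i < Polynomial.degree g"
  shows "p dvd poly.coeff g i"
proof (rule ccontr)
  assume "\<not> p dvd poly.coeff g i"
  define d where "d = Polynomial.degree g"
  obtain q where q: "Polynomial.monom 1 N + Polynomial.smult p k = g * q"
    using dvd by (elim dvdE)
  \<comment> \<open>Modulo \<open>p\<close> the product is just \<open>X^N\<close>.\<close>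
  have coeff: "p dvd poly.coeff (g * q) m \<longleftrightarrow> m \<noteq> N" for m
    using p by (auto simp flip: q simp: dvd_add_left_iff)
  have gd: "\<not> p dvd poly.coeff g d"
    using monic p not_prime_unit[of p] unfolding d_def by metis
  define J where "J = {j. \<not> p dvd poly.coeff q j}"
  have "J \<subseteq> {..Polynomial.degree q}"
  proof
    fix j assume "j \<in> J"
    then have "poly.coeff q j \<noteq> 0" by (auto simp: J_def)
    then show "j \<in> {..Polynomial.degree q}" by (simp add: le_degree)
  qed
  then have fin: "finite J" using finite_subset by blast
  have ne: "J \<noteq> {}"
  proof
    assume "J = {}"
    then have "p dvd poly.coeff (g * q) N"
      by (auto simp: coeff_mult J_def intro!: dvd_sum)
    then show False using coeff by blast
  qed
  define R where "R = (\<lambda>i. \<not> p dvd poly.coeff g i)"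
  define i0 where "i0 = (LEAST i. R i)"
  have "R i" using \<open>\<not> p dvd poly.coeff g i\<close> by (simp add: R_def)
  then have i0: "\<not> p dvd poly.coeff g i0" "i0 \<le> i"
    unfolding i0_def using LeastI[of R i] Least_le[of R i] by (simp_all add: R_def)
  have i0_min: "p dvd poly.coeff g l" if "l < i0" for l
    using not_less_Least[of l R] that by (simp add: i0_def R_def)
  have "\<not> p dvd poly.coeff (g * q) (i0 + Min J)"
  proof (rule coeff_mult_not_dvd[OF p i0(1)])
    show "\<not> p dvd poly.coeff q (Min J)" using Min_in[OF fin ne] by (simp add: J_def)
    fix l assume "l \<le> i0 + Min J" "l \<noteq> i0"
    then consider "l < i0" | "i0 + Min J - l < Min J" by linarith
    then show "p dvd poly.coeff g l \<or> p dvd poly.coeff q (i0 + Min J - l)"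
      using i0_min Min_le[OF fin, of "i0 + Min J - l"] by cases (auto simp: J_def)
  qed
  moreover have "\<not> p dvd poly.coeff (g * q) (d + Max J)"
  proof (rule coeff_mult_not_dvd[OF p gd])
    show "\<not> p dvd poly.coeff q (Max J)" using Max_in[OF fin ne] by (simp add: J_def)
    fix l assume "l \<le> d + Max J" "l \<noteq> d"
    then consider "l > d" | "d + Max J - l > Max J" by linarith
    then show "p dvd poly.coeff g l \<or> p dvd poly.coeff q (d + Max J - l)"
      using Max_ge[OF fin, of "d + Max J - l"] by cases (auto simp: J_def d_def coeff_eq_0)
  qed
  \<comment> \<open>Both surviving indices must be \<open>N\<close>, which is impossible since
    \<open>i0 < d\<close> and \<open>Min J <= Max J\<close>.\<close>
  ultimately have "i0 + Min J = d + Max J"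
    using coeff by metis
  moreover have "Min J \<le> Max J" using fin ne by simp
  ultimately show False using i i0(2) by (simp add: d_def)
qed

text \<open>Integrality of \<open>x^n / p\<close> makes \<open>g\<close> congruent to a power of
  \<open>X\<close> modulo \<open>p\<close>, and integrality of \<open>1 / (x + a)\<close> makes
  \<open>g(-a)\<close> equal to 1 or -1. Comparing the two at \<open>-a\<close> gives the
  congruence; squaring absorbs both signs.\<close>

lemma minimal_ipoly_residue:
  fixes x y z :: "'a::field_char_0" and p a :: int
  assumes p: "Factorial_Ring.prime p"
    and monic: "Polynomial.lead_coeff g = 1" and min: "\<And>k. ipoly k x = 0 \<Longrightarrow> g dvd k"
    and y: "algebraic_int y" "x ^ n = of_int p * y"
    and z: "algebraic_int z" "(x + of_int a) * z = 1"
  shows "[a ^ (2 * Polynomial.degree g) = 1] (mod p)"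
proof -
  define d where "d = Polynomial.degree g"
  obtain m k where "ipoly (Polynomial.monom 1 n ^ m + [:p:] * k) x = 0"
    using algebraic_int_quotient_relation[OF y(1), of "Polynomial.monom 1 n" x "[:p:]"] y(2)
    by (auto simp: map_poly_monom poly_monom mult.commute)
  then have "g dvd Polynomial.monom 1 (n * m) + Polynomial.smult p k"
    using min by (auto simp: monom_power)
  then have coeffs: "p dvd poly.coeff g i" if "i < d" for i
    using monic_dvd_monom_mod_prime[OF p monic] that by (auto simp: d_def)
  \<comment> \<open>Numerator 1 and denominator \<open>X + a\<close>: evaluation at
    \<open>-a\<close> annihilates the denominator and leaves \<open>g(-a)\<close> as a divisor of
    1.\<close>
  obtain m' k' where "ipoly (1 ^ m' + [:a, 1:] * k') x = 0"
    using algebraic_int_quotient_relation[OF z(1), of 1 x "[:a, 1:]"] z(2)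
    by (auto simp: map_poly_pCons algebra_simps)
  then have "g dvd 1 + [:a, 1:] * k'"
    using min by simp
  then obtain q where "1 + [:a, 1:] * k' = g * q" by (elim dvdE)
  from arg_cong[OF this, of "\<lambda>f. poly f (- a)"] have "poly g (- a) * poly q (- a) = 1"
    by simp
  then have unit: "poly g (- a) ^ 2 = 1"
    by (auto simp: zmult_eq_1_iff)
  have "poly g (- a) = (- a) ^ d + (\<Sum>i<d. poly.coeff g i * (- a) ^ i)"
    using monic by (simp add: poly_altdef d_def lessThan_Suc_atMost[symmetric] add.commute del: lessThan_Suc_atMost)
  moreover have "p dvd (\<Sum>i<d. poly.coeff g i * (- a) ^ i)"
    using coeffs by (intro dvd_sum) simp
  ultimately have "[poly g (- a) = (- a) ^ d] (mod p)"
    by (simp add: cong_iff_dvd_diff)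
  then have "[poly g (- a) ^ 2 = ((- a) ^ d) ^ 2] (mod p)"
    by (rule cong_pow)
  moreover have "((- a) ^ d) ^ 2 = a ^ (2 * d)"
    by (simp add: power_mult[symmetric] mult.commute)
  ultimately show ?thesis
    by (simp add: unit d_def cong_sym)
qed

text \<open>Fermat's little theorem and Bezout: the exponents \<open>2 * d\<close> and
  \<open>p - 1\<close> have greatest common divisor 2.\<close>

lemma power_cong_one_imp_square_cong_one:
  fixes a :: int and p d :: nat
  assumes p: "Factorial_Ring.prime p" "odd p" and d: "d > 0" "gcd d ((p - 1) div 2) = 1"
    and a: "[a ^ (2 * d) = 1] (mod int p)"
  shows "[a ^ 2 = 1] (mod int p)"
proof -
  have "\<not> int p dvd a"
  proof
    assume "int p dvd a"
    then have "int p dvd a ^ (2 * d)" using d(1) dvd_trans[OF _ dvd_power[of "2 * d" a]] by simp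
    then have "int p dvd 1" using a by (metis cong_dvd_iff)
    then show False using p(1) by simp
  qed
  define b where "b = nat (a mod int p)"
  have p0: "p > 0" using p(1) prime_gt_0_nat by blast
  have b: "[int b = a] (mod int p)" using p0 by (simp add: b_def cong_def)
  then have "\<not> p dvd b" using \<open>\<not> int p dvd a\<close> by (metis cong_dvd_iff int_dvd_int_iff)
  then have "[b ^ (p - 1) = 1] (mod p)" by (rule fermat_theorem[OF p(1)])
  then have "[int b ^ (p - 1) = 1] (mod int p)"
    by (metis cong_int_iff of_nat_1 of_nat_power)
  then have fermat: "[a ^ (p - 1) = 1] (mod int p)"
    using cong_pow[OF b, of "p - 1"] by (meson cong_sym cong_trans)
  have "p - 1 = 2 * ((p - 1) div 2)" using p(2) by simp
  then have "gcd (2 * d) (p - 1) = 2"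
    using d(2) gcd_mult_distrib_nat[of 2 d "(p - 1) div 2"] by simp
  then obtain u v where uv: "2 * d * u = (p - 1) * v + 2"
    using bezout_nat[of "2 * d" "p - 1"] d(1) by auto
  have "[a ^ (2 * d * u) = 1] (mod int p)"
    using cong_pow[OF a, of u] by (simp add: power_mult)
  moreover have "[a ^ ((p - 1) * v + 2) = 1 * a ^ 2] (mod int p)"
    unfolding power_add using cong_pow[OF fermat, of v]
    by (intro cong_mult) (simp_all add: power_mult)
  ultimately show ?thesis
    unfolding uv by (metis cong_sym cong_trans mult_1)
qed

section \<open>Subfields of finite degree over the rationals\<close>

lemma ring_of_type_algebra_simps [simp]:
  "carrier ring_of_type_algebra = UNIV"
  "\<zero>\<^bsub>ring_of_type_algebra\<^esub> = 0"
  "\<one>\<^bsub>ring_of_type_algebra\<^esub> = 1"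
  "x \<oplus>\<^bsub>ring_of_type_algebra\<^esub> y = x + y"
  "x \<otimes>\<^bsub>ring_of_type_algebra\<^esub> y = x * y"
  by (simp_all add: ring_of_type_algebra_def)

interpretation type_field: domain "ring_of_type_algebra :: 'a::field ring"
  by (rule field.axioms(1)[OF field_from_type_algebra])

lemma ring_of_type_algebra_a_inv [simp]: "\<ominus>\<^bsub>ring_of_type_algebra\<^esub> (x :: 'a::field) = - x"
  by (rule type_field.minus_equality) simp_all

lemma ring_of_type_algebra_power [simp]: "(x :: 'a::field) [^]\<^bsub>ring_of_type_algebra\<^esub> (k::nat) = x ^ k"
  by (induction k) (simp_all add: mult.commute)

lemma subring_type_field_iff:
  "subring (K :: 'a::field_char_0 set) ring_of_type_algebra \<longleftrightarrow>
     1 \<in> K \<and> (\<forall>x\<in>K. - x \<in> K) \<and> (\<forall>x\<in>K. \<forall>y\<in>K. x + y \<in> K \<and> x * y \<in> K)"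
  using type_field.subringI[of K] subringE[of K ring_of_type_algebra] by auto

lemma subfield_Rats: "subfield (\<rat> :: 'a::field_char_0 set) ring_of_type_algebra"
proof (rule field.subfieldI'[OF field_from_type_algebra])
  show "subring (\<rat> :: 'a set) ring_of_type_algebra"
    by (auto simp: subring_type_field_iff)
  fix k :: 'a assume k: "k \<in> \<rat> - {\<zero>\<^bsub>ring_of_type_algebra\<^esub>}"
  then have "inv\<^bsub>ring_of_type_algebra\<^esub> k = inverse k"
    by (intro type_field.comm_inv_char) auto
  then show "inv\<^bsub>ring_of_type_algebra\<^esub> k \<in> \<rat>" using k by simp
qed

section \<open>Linear dependence with integer coefficients, and degrees in towers\<close>

lemma combine_eq_sum:
  assumes "length Ks = length Us"
  shows "type_field.combine Ks Us = (\<Sum>i<length Us. Ks ! i * Us ! i)"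
  using assms
  by (induction Ks Us rule: list_induct2) (simp_all add: sum.lessThan_Suc_shift del: sum.lessThan_Suc)

lemma Rats_common_denominator:
  fixes r :: "nat \<Rightarrow> 'a::field_char_0"
  assumes "\<And>i. i < m \<Longrightarrow> r i \<in> \<rat>"
  obtains D :: int and z where "D \<noteq> 0" "\<And>i. i < m \<Longrightarrow> of_int D * r i = of_int (z i)"
proof -
  have "\<exists>D z. D \<noteq> 0 \<and> (\<forall>i<m. of_int D * r i = of_int (z i))"
    using assms
  proof (induction m)
    case 0
    then show ?case by (auto intro: exI[of _ 1])
  next
    case (Suc m)
    have "\<exists>D z. D \<noteq> 0 \<and> (\<forall>i<m. of_int D * r i = of_int (z i))"
      using Suc.prems by (intro Suc.IH) auto
    then obtain D z where Dz: "D \<noteq> 0" "\<forall>i<m. of_int D * r i = of_int (z i)"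
      by blast
    obtain a b where ab: "b > 0" "r m = of_int a / of_int b"
      using Suc.prems[of m] by (auto elim: Rats_cases')
    have "of_int (D * b) * r i = of_int (if i < m then b * z i else D * a)" if "i < Suc m" for i
      using that Dz(2) ab by (cases "i = m") (auto simp: less_Suc_eq mult_ac)
    moreover have "D * b \<noteq> 0" using Dz ab by simp
    ultimately show ?case
      by (intro exI[of _ "D * b"] exI[of _ "\<lambda>i. if i < m then b * z i else D * a"]) simp
  qed
  then show thesis using that by blast
qed

lemma dimension_Rats_dependent_int:
  fixes u :: "nat \<Rightarrow> 'a::field_char_0"
  assumes "type_field.dimension n \<rat> E" "\<And>i. i \<le> n \<Longrightarrow> u i \<in> E"
  obtains c :: "nat \<Rightarrow> int" where "\<exists>i\<le>n. c i \<noteq> 0" "(\<Sum>i\<le>n. of_int (c i) * u i) = 0"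
proof -
  define Us where "Us = map u [0..<Suc n]"
  have "set Us \<subseteq> E" using assms(2) by (auto simp: Us_def)
  then have "type_field.dependent \<rat> Us"
    using type_field.independent_length_le_dimension[OF subfield_Rats assms(1), of Us]
    by (auto simp: Us_def)
  then obtain Ks where Ks: "length Ks = length Us" "type_field.combine Ks Us = 0" "set Ks \<subseteq> \<rat>" "set Ks \<noteq> {0}"
    using type_field.dependent_imp_non_trivial_combine[OF subfield_Rats, of Us] by auto
  have len: "length Us = Suc n" by (simp add: Us_def)
  have "Ks ! i \<in> \<rat>" if "i < Suc n" for i using Ks(1,3) len that nth_mem by fastforce
  then obtain D z where D: "D \<noteq> 0" and z: "\<And>i. i < Suc n \<Longrightarrow> of_int D * Ks ! i = of_int (z i)"
    using Rats_common_denominator[of "Suc n" "(!) Ks"] by metis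
  have "0 = of_int D * (\<Sum>i<Suc n. Ks ! i * Us ! i)"
    using Ks(1,2) len by (simp only: combine_eq_sum mult_zero_right)
  also have "\<dots> = (\<Sum>i<Suc n. of_int (z i) * u i)"
    unfolding sum_distrib_left
  proof (rule sum.cong)
    fix i assume "i \<in> {..<Suc n}"
    then have "i < Suc n" "Us ! i = u i" by (auto simp: Us_def simp del: upt_Suc)
    then show "of_int D * (Ks ! i * Us ! i) = of_int (z i) * u i"
      by (metis z mult.assoc)
  qed simp
  finally have sum0: "(\<Sum>i\<le>n. of_int (z i) * u i) = 0"
    by (simp only: lessThan_Suc_atMost)
  have "Ks \<noteq> []" using Ks(1) len by auto
  then have "\<exists>k\<in>set Ks. k \<noteq> 0" using Ks(4)
    by (metis all_not_in_conv set_empty subset_singleton_iff singletonI subsetI singleton_iff)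
  then obtain i where "i < Suc n" "Ks ! i \<noteq> 0"
    using Ks(1) len by (metis in_set_conv_nth)
  then have "z i \<noteq> 0" using z[of i] D by auto
  then show thesis using that[of z] sum0 \<open>i < Suc n\<close> less_Suc_eq_le by blast
qed

text \<open>Dividing an integer relation by the gcd of its coefficients leaves one that is
  nontrivial modulo \<open>p\<close>. The dimension bound for the quotient by \<open>p\<close> is
  used in this form, so no integral basis has to be constructed.\<close>

lemma dimension_Rats_dependent_mod_prime:
  fixes u :: "nat \<Rightarrow> 'a::field_char_0" and p :: int
  assumes "Factorial_Ring.prime p" "type_field.dimension n \<rat> E" "\<And>i. i \<le> n \<Longrightarrow> u i \<in> E"
  obtains c :: "nat \<Rightarrow> int" where "\<exists>i\<le>n. \<not> p dvd c i" "(\<Sum>i\<le>n. of_int (c i) * u i) = 0"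
proof -
  obtain c where c: "\<exists>i\<le>n. c i \<noteq> 0" "(\<Sum>i\<le>n. of_int (c i) * u i) = 0"
    using dimension_Rats_dependent_int[of n E u] assms(2,3) by blast
  define g where "g = Gcd (c ` {..n})"
  have g0: "g \<noteq> 0" using c(1) by (auto simp: g_def Gcd_0_iff)
  define c' where "c' i = c i div g" for i
  have c': "c i = g * c' i" if "i \<le> n" for i
    using that by (simp add: c'_def g_def Gcd_dvd)
  have "\<exists>i\<le>n. \<not> p dvd c' i"
  proof (rule ccontr)
    assume "\<not> ?thesis"
    then have "g * p dvd c i" if "i \<le> n" for i using c'[OF that] that by auto
    then have "g * p dvd Gcd (c ` {..n})"
      by (intro Gcd_greatest) auto
    then have "g * p dvd g * 1"
      by (simp only: g_def mult_1_right)
    then have "is_unit p" using g0 by (simp only: dvd_mult_cancel_left) auto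
    then show False using assms(1) not_prime_unit by blast
  qed
  moreover have "of_int g * (\<Sum>i\<le>n. of_int (c' i) * u i) = 0"
    using c(2) by (simp add: sum_distrib_left mult.assoc[symmetric] flip: of_int_mult c')
  ultimately show thesis using that[of c'] g0 by auto
qed

text \<open>A list spanning \<open>E\<close> over \<open>K\<close> also spans it over the larger
  field \<open>L\<close>. This provides the upper step of the tower in the degree formula.\<close>

lemma (in ring) finite_dimension_intermediate:
  assumes "subfield K R" "subfield L R" "subring E R" "K \<subseteq> L" "L \<subseteq> E" "finite_dimension K E"
  shows "finite_dimension L E"
proof -
  obtain Vs where Vs: "set Vs \<subseteq> carrier R" "Span K Vs = E"
    using assms(6) exists_base[OF assms(1)] by blast
  have "Span K Us \<subseteq> Span L Us" for Us
    using assms(4) by (induction Us) (simp, simp add: subset_iff line_extension_mem_iff, blast)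
  then have "E \<subseteq> Span L Vs" using Vs(2) by blast
  moreover have "subalgebra L E R"
  proof (intro subalgebra.intro subalgebra_axioms.intro)
    show "subgroup E (add_monoid R)" using assms(3) by (rule subring.axioms(1))
    show "k \<otimes> v \<in> E" if "k \<in> L" "v \<in> E" for k v
      using that assms(5) subringE(6)[OF assms(3)] by blast
  qed
  then have "Span L Vs \<subseteq> E"
    using subalgebra_Span_incl[OF assms(2)] Span_base_incl[OF assms(1) Vs(1)] Vs(2) by blast
  ultimately have "Span L Vs = E" by blast
  then show ?thesis using Span_finite_dimension[OF assms(2) Vs(1)] by simp
qed

text \<open>The degree of \<open>f\<close> is that of the simple extension \<open>?K\<close> over
  the rationals, which divides \<open>n\<close> by the tower law. The two degrees agree because the
  powers of \<open>x\<close> below the \<open>d\<close>-th are independent, while adding the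
  \<open>d\<close>-th makes them dependent.\<close>

lemma minimal_ipoly_degree_dvd:
  fixes F :: "'a::field_char_0 set"
  assumes F: "number_field_of_degree n F" and x: "x \<in> F"
    and monic: "Polynomial.lead_coeff f = 1" and fx: "ipoly f x = 0"
    and min: "\<And>k. ipoly k x = 0 \<Longrightarrow> f dvd k"
  shows "Polynomial.degree f dvd n"
proof -
  let ?K = "type_field.simple_extension \<rat> x"
  \<comment> \<open>\<open>Irr\<close> is a coefficient list, hence one longer than its
    degree.\<close>
  define d where "d = length (type_field.Irr \<rat> x) - 1"
  have subF: "subfield F ring_of_type_algebra" and dimF: "type_field.dimension n \<rat> F"
    using F by (auto simp: number_field_of_degree_def)
  note subr = subfieldE(1)[OF subF]
  have fin: "type_field.finite_dimension \<rat> F"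
    using type_field.finite_dimensionI[OF dimF] .
  have alg: "(type_field.algebraic over \<rat>) x"
    using type_field.finite_dimension_imp_algebraic[OF subfield_Rats subr fin x] .
  have subK: "subfield ?K ring_of_type_algebra"
    using type_field.simple_extension_is_subfield[OF subfield_Rats, of x] alg by simp
  have dimK: "type_field.dimension d \<rat> ?K"
    using type_field.dimension_simple_extension[OF subfield_Rats _ alg] by (simp add: d_def)
  have RatsF: "\<rat> \<subseteq> F"
  proof
    fix q :: 'a assume "q \<in> \<rat>"
    moreover have "1 \<in> F" using subringE(3)[OF subr] by simp
    ultimately show "q \<in> F"
      using type_field.space_subgroup_props(5)[OF subfield_Rats dimF, of q 1] by simp
  qed
  have KF: "?K \<subseteq> F"
    using type_field.simple_extension_subring_incl[OF subr RatsF x] .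
  have RatsK: "\<rat> \<subseteq> ?K"
    using type_field.simple_extension_incl[of \<rat> x] by simp
  have finKF: "type_field.finite_dimension ?K F"
    using type_field.finite_dimension_intermediate[OF subfield_Rats subK subr RatsK KF fin] .
  then obtain m where "type_field.dimension m ?K F" by blast
  then have "type_field.dimension (d * m) \<rat> F"
    using type_field.telescopic_base[OF subfield_Rats subK dimK] by blast
  then have dn: "d dvd n"
    using type_field.dimension_is_inj[OF subfield_Rats dimF] by auto
  have xK: "x \<in> ?K"
    using type_field.simple_extension_mem[OF subfieldE(1)[OF subfield_Rats], of x] by simp
  have powK: "x ^ i \<in> ?K" for i
    using subringE(3,6)[OF subfieldE(1)[OF subK]] xK by (induction i) auto
  have "Polynomial.degree f \<le> d"
  proof -
    obtain c :: "nat \<Rightarrow> int" where c: "\<exists>i\<le>d. c i \<noteq> 0" "(\<Sum>i\<le>d. of_int (c i) * x ^ i) = 0"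
      using dimension_Rats_dependent_int[OF dimK, of "\<lambda>i. x ^ i"] powK by blast
    define k where "k = (\<Sum>i\<le>d. Polynomial.monom (c i) i)"
    have coeff: "poly.coeff k i = (if i \<le> d then c i else 0)" for i
      by (simp add: k_def coeff_sum)
    have "ipoly k x = (\<Sum>i\<le>d. of_int (c i) * x ^ i)"
      by (simp add: k_def ipoly_sum map_poly_monom poly_monom)
    then have "f dvd k" using c(2) min by simp
    moreover have "k \<noteq> 0" using c(1) coeff by (metis coeff_0)
    moreover have "Polynomial.degree k \<le> d" by (rule degree_le) (simp add: coeff)
    ultimately show ?thesis using dvd_imp_degree_le[of f k] by linarith
  qed
  moreover have "\<not> Polynomial.degree f < d"
  proof
    assume less: "Polynomial.degree f < d"
    \<comment> \<open>The reversal matches \<open>exp_base\<close>, which lists the powers in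
      descending order.\<close>
    define Us where "Us = map (\<lambda>i. x ^ i) (rev [0..<d])"
    define Ks where "Ks = map (\<lambda>i. of_int (poly.coeff f i) :: 'a) (rev [0..<d])"
    have "type_field.independent \<rat> Us"
      using type_field.exp_base_independent[OF subfield_Rats _ alg]
      by (simp add: type_field.exp_base_def d_def Us_def)
    moreover have "set Ks \<subseteq> \<rat>" by (auto simp: Ks_def)
    moreover have "type_field.combine Ks Us = 0"
    proof -
      have "type_field.combine Ks Us = (\<Sum>i<d. of_int (poly.coeff f (d - Suc i)) * x ^ (d - Suc i))"
        by (subst combine_eq_sum) (simp_all add: Ks_def Us_def rev_nth)
      also have "\<dots> = (\<Sum>i<d. of_int (poly.coeff f i) * x ^ i)"
        by (rule sum.nat_diff_reindex)
      also have "\<dots> = ipoly f x"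
        unfolding ipoly_altdef using less
        by (intro sum.mono_neutral_right) (auto simp: coeff_eq_0)
      finally show ?thesis using fx by simp
    qed
    ultimately have "set (take (length Us) Ks) \<subseteq> {0}"
      using type_field.independent_imp_trivial_combine[OF subfield_Rats, of Us Ks] by simp
    then have "\<forall>i<d. poly.coeff f i = 0"
      by (simp add: Us_def Ks_def image_subset_iff)
    then show False using monic less by simp
  qed
  ultimately show ?thesis using dn by simp
qed

section \<open>The filtration by powers of a totally ramified prime\<close>

text \<open>\<open>Q i\<close> plays the role of the \<open>i\<close>-th power of the ramified prime, with \<open>S\<close> the ring of integers.\<close>

locale totally_ramified_filtration =
  fixes S :: "'a::field_char_0 set" and Q :: "nat \<Rightarrow> 'a set" and n :: nat and p :: int
  assumes p: "Factorial_Ring.prime p"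
    and dependent: "\<And>u. (\<And>i. i \<le> n \<Longrightarrow> u i \<in> S) \<Longrightarrow>
          \<exists>c :: nat \<Rightarrow> int. (\<exists>i\<le>n. \<not> p dvd c i) \<and> (\<Sum>i\<le>n. of_int (c i) * u i) = 0"
    and n: "n > 0"
    and S: "of_int c \<in> S" "x \<in> S \<Longrightarrow> y \<in> S \<Longrightarrow> x + y \<in> S" "x \<in> S \<Longrightarrow> y \<in> S \<Longrightarrow> x * y \<in> S"
    and Q0: "Q 0 = S"
    and Q_zero: "0 \<in> Q i"
    and Q_add: "x \<in> Q i \<Longrightarrow> y \<in> Q i \<Longrightarrow> x + y \<in> Q i"
    and Q_smult: "x \<in> S \<Longrightarrow> y \<in> Q i \<Longrightarrow> x * y \<in> Q i"
    and Q_Suc: "Q (Suc i) \<subseteq> Q i"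
    and Q_mult: "x \<in> Q i \<Longrightarrow> y \<in> Q 1 \<Longrightarrow> x * y \<in> Q (Suc i)"
    and Q_n: "Q n = {of_int p * y | y. y \<in> S}"
    and Q_strict: "i < n \<Longrightarrow> Q (Suc i) \<noteq> Q i"
begin

lemma Q_antimono: "i \<le> j \<Longrightarrow> Q j \<subseteq> Q i"
  using lift_Suc_antimono_le[of Q] Q_Suc by blast

lemma Q_subset: "Q i \<subseteq> S"
  using Q_antimono[of 0 i] Q0 by simp

lemma Q_power: "x \<in> Q 1 \<Longrightarrow> x ^ k \<in> Q k"
  using S(1)[of 1] Q_mult[of "x ^ _" _ x] by (induction k) (simp_all add: Q0 mult.commute)

lemma dvd_mem_Q: "p dvd c \<Longrightarrow> i \<le> n \<Longrightarrow> x \<in> S \<Longrightarrow> of_int c * x \<in> Q i"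
  using Q_antimono[of i n] S(1,3) by (fastforce simp: Q_n mult.assoc elim!: dvdE)

lemma Q_uminus: "x \<in> Q i \<Longrightarrow> - x \<in> Q i"
  using Q_smult[of "of_int (-1)" x i] S(1)[of "-1"] by simp

lemma Q_sum: "(\<And>j. j \<in> J \<Longrightarrow> f j \<in> Q i) \<Longrightarrow> (\<Sum>j\<in>J. f j) \<in> Q i"
  by (induction J rule: infinite_finite_induct) (auto intro: Q_add Q_zero)

lemma not_dvd_bezout:
  assumes "\<not> p dvd c"
  shows "\<exists>a b. a * c + b * p = 1"
proof -
  have "gcd c p = 1"
    using prime_imp_coprime[OF p assms] by (simp add: coprime_iff_gcd_eq_1 gcd.commute)
  then show ?thesis using bezout_int[of c p] by simp
qed

text \<open>\<open>c\<close> is invertible modulo \<open>p\<close>, and \<open>p\<close> times any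
  element of \<open>S\<close> lies in every \<open>Q i\<close> with \<open>i <= n\<close>.\<close>

lemma Q_cancel_int:
  assumes "\<not> p dvd c" "of_int c * x \<in> Q i" "x \<in> S" "i \<le> n"
  shows "x \<in> Q i"
proof -
  obtain a b where "a * c + b * p = 1"
    using not_dvd_bezout[OF assms(1)] by blast
  then have "of_int a * of_int c + of_int b * of_int p = (1 :: 'a)"
    by (metis of_int_1 of_int_add of_int_mult)
  then have "x = of_int a * (of_int c * x) + of_int (b * p) * x"
    by (metis distrib_right mult.assoc mult_1 of_int_mult)
  moreover have "of_int (b * p) * x \<in> Q i"
    using assms by (intro dvd_mem_Q) auto
  ultimately show ?thesis
    using Q_add[OF Q_smult[OF S(1) assms(2)], of "of_int (b * p) * x" a] by simp
qed

lemma one_notin_Q1: "1 \<notin> Q 1"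
proof
  assume "1 \<in> Q 1"
  then have "s \<in> Q 1" if "s \<in> S" for s using Q_smult[of s 1 1] that by simp
  then have "S \<subseteq> Q 1" by blast
  then show False using Q_strict[OF n] Q_Suc[of 0] Q0 by simp
qed

text \<open>In effect, the residue field is the prime field. One element from each of the
  \<open>n\<close> strict steps, together with \<open>x\<close>, satisfies a relation that is
  nontrivial modulo \<open>p\<close>. Descending the filtration shows that the coefficient of
  \<open>x\<close> is prime to \<open>p\<close>, and modulo \<open>Q 1\<close> the relation can then
  be solved for \<open>x\<close>.\<close>

lemma ex_int_residue:
  assumes x: "x \<in> S"
  obtains a :: int where "x - of_int a \<in> Q 1"
proof -
  have "\<exists>y. y \<in> Q i - Q (Suc i)" if "i < n" for i
    using Q_strict[OF that] Q_Suc[of i] by blast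
  then obtain w where w: "\<And>i. i < n \<Longrightarrow> w i \<in> Q i - Q (Suc i)" by metis
  \<comment> \<open>Taking 1 at index 0 makes the relation compare \<open>x\<close> with a rational
    integer modulo \<open>Q 1\<close>.\<close>
  define v where "v i = (if i = 0 then 1 else w i)" for i
  have v: "v i \<in> Q i" "v i \<notin> Q (Suc i)" if "i < n" for i
    using w[OF that] one_notin_Q1 S(1)[of 1] by (auto simp: v_def Q0)
  define u where "u i = (if i = n then x else v i)" for i
  have uS: "u i \<in> S" if "i \<le> n" for i
    using that x v(1)[of i] Q_subset[of i] by (cases "i = n") (auto simp: u_def)
  obtain c :: "nat \<Rightarrow> int" where c: "\<exists>i\<le>n. \<not> p dvd c i" "(\<Sum>i\<le>n. of_int (c i) * u i) = 0"
    using dependent[of u] uS by blast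
  have isolate: "of_int (c i) * u i = - (\<Sum>j\<in>{..n} - {i}. of_int (c j) * u j)" if "i \<le> n" for i
    using c(2) that by (simp add: sum.remove[of _ i] eq_neg_iff_add_eq_0)
  show thesis
  proof (cases "p dvd c n")
    case True
    \<comment> \<open>Modulo \<open>Q (Suc i)\<close> the terms before \<open>i\<close> vanish by
      induction, the later ones by their place in the filtration, and the term of \<open>x\<close>
      by the case assumption. So \<open>p\<close> would divide every coefficient.\<close>
    have "p dvd c i" if "i < n" for i
      using that
    proof (induction i rule: less_induct)
      case (less i)
      have "of_int (c j) * u j \<in> Q (Suc i)" if "j \<in> {..n} - {i}" for j
      proof -
        have j: "j \<le> n" "j \<noteq> i" using that by auto
        consider "j < i" | "j = n" | "i < j" "j < n" using j by linarith
        then show ?thesis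
        proof cases
          case 3
          then have "u j \<in> Q (Suc i)"
            using v(1)[of j] Q_antimono[of "Suc i" j] by (auto simp: u_def)
          then show ?thesis by (intro Q_smult S)
        qed (use less True uS[of j] j in \<open>auto intro!: dvd_mem_Q\<close>)
      qed
      then have "(\<Sum>j\<in>{..n} - {i}. of_int (c j) * u j) \<in> Q (Suc i)"
        by (rule Q_sum)
      then have "of_int (c i) * u i \<in> Q (Suc i)"
        using isolate[of i] less.prems Q_uminus by simp
      moreover have "u i \<notin> Q (Suc i)" using v(2) less.prems by (simp add: u_def)
      ultimately show ?case using Q_cancel_int[of "c i" "u i" "Suc i"] uS[of i] less.prems by auto
    qed
    then have "p dvd c i" if "i \<le> n" for i
      using True that by (cases "i = n") auto
    then show thesis using c(1) by blast
  next
    case False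
    \<comment> \<open>\<open>e\<close> is the solution modulo \<open>p\<close> of the relation read
      modulo \<open>Q 1\<close>, where only the terms at indices 0 and \<open>n\<close>
      remain.\<close>
    obtain e where e: "p dvd c n * e + c 0"
    proof -
      obtain a b where ab: "a * c n + b * p = 1"
        using not_dvd_bezout[OF False] by blast
      have "c n * (- a * c 0) + c 0 = c 0 * (1 - a * c n)"
        by (simp add: algebra_simps)
      also have "\<dots> = p * (b * c 0)"
        by (simp flip: ab)
      finally show thesis using that[of "- a * c 0"] by simp
    qed
    have "of_int (c n) * (x - of_int e)
        = - (of_int (c n * e + c 0) * 1 + (\<Sum>j\<in>{..n} - {n} - {0}. of_int (c j) * u j))"
      using isolate[of n] n sum.remove[of "{..n} - {n}" 0 "\<lambda>j. of_int (c j) * u j"]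
      by (simp add: u_def v_def algebra_simps)
    moreover have "(\<Sum>j\<in>{..n} - {n} - {0}. of_int (c j) * u j) \<in> Q 1"
    proof (rule Q_sum)
      fix j assume j: "j \<in> {..n} - {n} - {0}"
      then have "u j \<in> Q 1"
        using v(1)[of j] Q_antimono[of 1 j] by (auto simp: u_def)
      then show "of_int (c j) * u j \<in> Q 1" by (intro Q_smult S)
    qed
    moreover have "of_int (c n * e + c 0) * 1 \<in> Q 1"
      using e n S(1)[of 1] by (intro dvd_mem_Q) auto
    ultimately have "of_int (c n) * (x - of_int e) \<in> Q 1"
      by (simp only: Q_uminus Q_add)
    moreover have "x - of_int e \<in> S"
      using S(2)[OF x S(1)[of "- e"]] by simp
    ultimately show thesis using Q_cancel_int[OF False] n that[of e] by force
  qed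
qed

end

section \<open>Powers of the ramified prime ideal in the ring of integers\<close>

lemma ring_of_integers_simps [simp]:
  "carrier (ring_of_integers F) = {x \<in> F. algebraic_int x}"
  "\<zero>\<^bsub>ring_of_integers F\<^esub> = 0"
  "\<one>\<^bsub>ring_of_integers F\<^esub> = 1"
  "x \<oplus>\<^bsub>ring_of_integers F\<^esub> y = x + y"
  "x \<otimes>\<^bsub>ring_of_integers F\<^esub> y = x * y"
  by (simp_all add: ring_of_integers_def ring_of_type_algebra_def)

text \<open>The filtration consists of the powers of \<open>P\<close> in the monoid of ideals.
  Strictness is the main point: an equality at one step propagates to
  \<open>Q (Suc n) = Q n\<close>, and cancelling \<open>p\<close> there would put 1 into
  \<open>P\<close>.\<close>

lemma totally_ramified_imp_filtration:
  fixes F :: "'a::field_char_0 set"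
  assumes F: "number_field_of_degree n F" and p: "Factorial_Ring.prime p" and ram: "totally_ramified p F"
  obtains Q where "totally_ramified_filtration {x \<in> F. algebraic_int x} Q n (int p)"
proof -
  let ?R = "ring_of_integers F"
  let ?S = "{x \<in> F. algebraic_int x}"
  obtain n' P where n': "number_field_of_degree n' F" and P: "primeideal P ?R"
    and eq: "PIdl\<^bsub>?R\<^esub> (of_nat p) = P [^]\<^bsub>ideals_set ?R\<^esub> n'"
    using ram by (auto simp: totally_ramified_def)
  have subF: "subfield F ring_of_type_algebra" and dimF: "type_field.dimension n \<rat> F"
    and dimF': "type_field.dimension n' \<rat> F"
    using F n' by (auto simp: number_field_of_degree_def)
  \<comment> \<open>The definition of \<open>totally_ramified\<close> quantifies its own degree;
    uniqueness of dimension identifies it with \<open>n\<close>.\<close>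
  have n'_eq: "n' = n"
    using type_field.dimension_is_inj[OF subfield_Rats dimF' dimF] .
  interpret P: primeideal P ?R by (rule P)
  interpret ideals: comm_monoid "ideals_set ?R"
    by (rule P.ideals_set_is_comm_monoid)
  define Q where "Q i = P [^]\<^bsub>ideals_set ?R\<^esub> i" for i :: nat
  have P_mem: "P \<in> carrier (ideals_set ?R)"
    by (simp add: ideals_set_def P.is_ideal)
  have "Q i \<in> carrier (ideals_set ?R)" for i
    using P_mem by (simp add: Q_def)
  then have ideal: "ideal (Q i) ?R" for i
    by (simp add: ideals_set_def)
  have Q0: "Q 0 = ?S"
    by (simp add: Q_def ideals_set_def)
  have QSuc: "Q (Suc i) = ideal_prod ?R (Q i) P" for i
    using P_mem by (simp add: Q_def) (simp add: ideals_set_def)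
  have Q1: "Q 1 = P" using P_mem by (simp add: Q_def)
  have of_int_S: "of_int c \<in> ?S" for c
  proof -
    have "of_int c \<in> F"
    proof -
      have "1 \<in> F" using subringE(3)[OF subfieldE(1)[OF subF]] by simp
      then show ?thesis
        using type_field.space_subgroup_props(5)[OF subfield_Rats dimF, of "of_int c" 1] by simp
    qed
    then show ?thesis by simp
  qed
  have Q_n: "Q n = {of_int (int p) * y | y. y \<in> ?S}"
    using eq by (auto simp: Q_def n'_eq cgenideal_def mult.commute)
  have one_P: "1 \<notin> P"
    using P.I_notcarr P.one_imp_carrier by auto
  have strict: "Q (Suc i) \<noteq> Q i" if "i < n" for i
  proof
    assume i: "Q (Suc i) = Q i"
    have stable: "Q (Suc (i + j)) = Q (i + j)" for j
    proof (induction j)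
      case 0
      then show ?case using i by simp
    next
      case (Suc j)
      then show ?case using QSuc[of "Suc (i + j)"] QSuc[of "i + j"] by simp
    qed
    have "Q (Suc n) = Q n" using stable[of "n - i"] that by simp
    moreover have "of_int (int p) * 1 \<in> Q n"
      using of_int_S[of 1] unfolding Q_n by (intro CollectI exI[of _ 1]) simp
    ultimately have "of_int (int p) \<in> ideal_prod ?R (Q n) P"
      using QSuc by simp
    \<comment> \<open>As \<open>Q n\<close> is \<open>p\<close> times the ring, its product with
      \<open>P\<close> lies in \<open>p\<close> times \<open>P\<close>.\<close>
    moreover have "\<exists>y\<in>P. z = of_int (int p) * y" if "z \<in> ideal_prod ?R (Q n) P" for z
      using that
    proof induction
      case (prod s t)
      then obtain y where "y \<in> ?S" "s = of_int (int p) * y" unfolding Q_n by blast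
      then show ?case
        using P.I_l_closed[of t y] prod by (intro bexI[of _ "y * t"]) (auto simp: mult.assoc)
    next
      case (sum s t)
      then obtain y z where "y \<in> P" "s = of_int (int p) * y" "z \<in> P" "t = of_int (int p) * z" by blast
      then show ?case
        using additive_subgroup.a_closed[OF P.additive_subgroup_axioms, of y z]
        by (intro bexI[of _ "y + z"]) (auto simp: distrib_left)
    qed
    ultimately obtain y where "y \<in> P" "of_int (int p) = of_int (int p) * y" by blast
    then have "1 \<in> P" using prime_gt_0_nat[OF p] by simp
    then show False using one_P by simp
  qed
  have "n > 0"
  proof (rule ccontr)
    assume "\<not> n > 0"
    then have "F = {0}" using type_field.dimension_zero[OF subfield_Rats, of F] dimF by simp
    then show False using of_int_S[of 1] by simp
  qed
  have "totally_ramified_filtration ?S Q n (int p)"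
  proof
    show "Factorial_Ring.prime (int p)" using p by simp
    show "\<exists>c :: nat \<Rightarrow> int. (\<exists>i\<le>n. \<not> int p dvd c i) \<and> (\<Sum>i\<le>n. of_int (c i) * u i) = 0"
      if "\<And>i. i \<le> n \<Longrightarrow> u i \<in> ?S" for u
    proof (rule dimension_Rats_dependent_mod_prime[of "int p" n F u])
      show "Factorial_Ring.prime (int p)" using p by simp
      show "u i \<in> F" if "i \<le> n" for i using \<open>\<And>i. i \<le> n \<Longrightarrow> u i \<in> ?S\<close>[OF that] by simp
      show ?thesis if "\<exists>i\<le>n. \<not> int p dvd c i" "(\<Sum>i\<le>n. of_int (c i) * u i) = 0" for c
        using that by (intro exI[of _ c] conjI)
    qed (rule dimF)
    show "n > 0" by fact
    show "of_int c \<in> ?S" for c by (rule of_int_S)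
    show "x + y \<in> ?S" if "x \<in> ?S" "y \<in> ?S" for x y using P.add.m_closed[of x y] that by simp
    show "x * y \<in> ?S" if "x \<in> ?S" "y \<in> ?S" for x y using P.m_closed[of x y] that by simp
    show "Q 0 = ?S" by (rule Q0)
    show "0 \<in> Q i" for i
      using additive_subgroup.zero_closed[OF ideal.axioms(1)[OF ideal[of i]]] by simp
    show "x + y \<in> Q i" if "x \<in> Q i" "y \<in> Q i" for x y i
      using additive_subgroup.a_closed[OF ideal.axioms(1)[OF ideal[of i]] that] by simp
    show "x * y \<in> Q i" if "x \<in> ?S" "y \<in> Q i" for x y i
      using ideal.I_l_closed[OF ideal[of i] that(2), of x] that by simp
    show "Q (Suc i) \<subseteq> Q i" for i
      unfolding QSuc using P.ideal_prod_inter[OF ideal[of i] P.is_ideal] by blast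
    show "x * y \<in> Q (Suc i)" if "x \<in> Q i" "y \<in> Q 1" for x y i
      using ideal_prod.prod[of x "Q i" y P ?R] that unfolding QSuc Q1 by simp
    show "Q n = {of_int (int p) * y | y. y \<in> ?S}" by (rule Q_n)
    show "Q (Suc i) \<noteq> Q i" if "i < n" for i using strict that by blast
  qed
  then show thesis by (rule that)
qed

section \<open>The unit equation\<close>

theorem theorem4:
  fixes F :: "'a::field_char_0 set" and n p :: nat
  assumes "number_field_of_degree n F"
    and "Factorial_Ring.prime p" and "p \<ge> 5"
    and "gcd n ((p - 1) div 2) = 1"
    and "totally_ramified p F"
  shows "\<not> (\<exists>l\<in>Units (ring_of_integers F). \<exists>m\<in>Units (ring_of_integers F). l + m = 1)"
proof
  assume "\<exists>l\<in>Units (ring_of_integers F). \<exists>m\<in>Units (ring_of_integers F). l + m = 1"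
  then obtain l m where l: "l \<in> Units (ring_of_integers F)" and m: "m \<in> Units (ring_of_integers F)"
    and lm: "l + m = 1" by blast
  let ?S = "{x \<in> F. algebraic_int x}"
  obtain Q where "totally_ramified_filtration ?S Q n (int p)"
    using totally_ramified_imp_filtration[OF assms(1,2,5)] .
  then interpret totally_ramified_filtration ?S Q n "int p" .
  have "odd p" using assms(2,3) prime_odd_nat[of p] by simp
  have residue: "\<exists>a. x - of_int a \<in> Q 1 \<and> [a ^ 2 = 1] (mod int p)"
    if x_unit: "x \<in> Units (ring_of_integers F)" for x
  proof -
    obtain z where x: "x \<in> ?S" and z: "z \<in> ?S" "x * z = 1"
      using x_unit by (auto simp: Units_def)
    obtain a where a: "x - of_int a \<in> Q 1" using ex_int_residue[OF x] .
    define w where "w = x - of_int a"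
    have w: "w \<in> F" "algebraic_int w" using a Q_subset[of 1] by (auto simp: w_def)
    obtain g where g: "Polynomial.lead_coeff g = 1" "ipoly g w = 0" "\<And>k. ipoly k w = 0 \<Longrightarrow> g dvd k"
      using algebraic_int_minimal_ipoly[OF w(2)] by blast
    \<comment> \<open>Total ramification turns membership of \<open>w\<close> in the prime into
      divisibility of \<open>w ^ n\<close> by \<open>p\<close>.\<close>
    have "w ^ n \<in> Q n" using a Q_power by (simp add: w_def)
    then obtain y where y: "y \<in> ?S" "w ^ n = of_int (int p) * y"
      unfolding Q_n by blast
    have "(w + of_int a) * z = 1" using z by (simp add: w_def)
    then have cong: "[a ^ (2 * Polynomial.degree g) = 1] (mod int p)"
      using minimal_ipoly_residue[OF p g(1), of w y n z a] g(3) y z by simp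
    have "Polynomial.degree g dvd n"
      using minimal_ipoly_degree_dvd[OF assms(1) w(1) g] .
    then have "Polynomial.degree g > 0" "gcd (Polynomial.degree g) ((p - 1) div 2) = 1"
      using n assms(4) coprime_divisors[of _ n "(p - 1) div 2" "(p - 1) div 2"]
      by (auto simp only: coprime_iff_gcd_eq_1 dvd_refl intro: dvd_pos_nat)
    then have "[a ^ 2 = 1] (mod int p)"
      using cong by (rule power_cong_one_imp_square_cong_one[OF assms(2) \<open>odd p\<close>])
    then show ?thesis using a by blast
  qed
  obtain a b where a: "l - of_int a \<in> Q 1" "[a ^ 2 = 1] (mod int p)"
    and b: "m - of_int b \<in> Q 1" "[b ^ 2 = 1] (mod int p)"
    using residue[OF l] residue[OF m] by blast
  have "(l - of_int a) + (m - of_int b) = of_int (1 - a - b) * 1"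
    using lm by (simp add: algebra_simps)
  then have "of_int (1 - a - b) * 1 \<in> Q 1" using Q_add[OF a(1) b(1)] by (simp only:)
  \<comment> \<open>Otherwise \<open>Q_cancel_int\<close> would put 1 into
    \<open>Q 1\<close>.\<close>
  then have "int p dvd 1 - a - b"
    using Q_cancel_int[of "1 - a - b" 1 1] one_notin_Q1 n S(1)[of 1] by auto
  moreover have "int p dvd a ^ 2 - 1" "int p dvd b ^ 2 - 1"
    using a(2) b(2) by (simp_all add: cong_iff_dvd_diff)
  \<comment> \<open>Substituting \<open>b = 1 - a\<close> turns \<open>b^2 - a^2\<close> into
    \<open>1 - 2 * a\<close>. Multiplying by \<open>2 * a + 1\<close> gives
    \<open>1 - 4 * a^2\<close>, and adding \<open>4 * (a^2 - 1)\<close> leaves -3.\<close>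
  moreover have "- 3 = (2 * a + 1) * ((b ^ 2 - 1) - (a ^ 2 - 1) + (1 - a - b) * (1 - a + b)) + 4 * (a ^ 2 - 1)"
    by (simp add: algebra_simps power2_eq_square)
  ultimately have "int p dvd - 3"
    by (metis dvd_add dvd_diff dvd_mult dvd_mult2)
  then show False using assms(3) zdvd_imp_le by fastforce
qed

end
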